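(* Let $G=(V,E)$ be a finite simple bipartite graph which has an orientation in which every vertex has out-degree at most $k$. Suppose each vertex $v\in V$ is assigned a non-constant polynomial $f_v\in\mathbb{R}[x]$ of degree at most $l$ with positive leading coefficient. Then there is a labeling $c:V\to\{1,2,\ldots,kl+1\}$ such that for every pair of adjacent vertices $u,w$, $$c(u)-\sum_{v\in N(u)}f_v(c(v))\neq c(w)-\sum_{v\in N(w)}f_v(c(v)).$$
   Context: $N(u)$ denotes the set of all neighbors of the vertex $u$ in $G$. *)

theory Defs
  imports
    "HOL-Computational_Algebra.Polynomial"
    "Graph_Theory.Pair_Digraph"
begin

text \<open>
  A finite simple graph is a \<open>pair_graph\<close>, that is, a finite loop-free digraph on pairs with a
  symmetric arc relation: the undirected edge between \<open>u\<close> and \<open>v\<close> is represented by the two arcs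
  \<open>(u, v)\<close> and \<open>(v, u)\<close>.
\<close>

definition neighbors :: "'a pair_pre_digraph \<Rightarrow> 'a \<Rightarrow> 'a set" where
  "neighbors G u = {v. (u, v) \<in> parcs G}"

definition bipartite :: "'a pair_pre_digraph \<Rightarrow> bool" where
  "bipartite G \<longleftrightarrow>
     (\<exists>A B. A \<union> B = pverts G \<and> A \<inter> B = {} \<and> parcs G \<subseteq> A \<times> B \<union> B \<times> A)"

text \<open>
  An orientation keeps exactly one of the two arcs that represent each undirected edge.
\<close>

definition orientation_of :: "'a pair_pre_digraph \<Rightarrow> 'a pair_pre_digraph \<Rightarrow> bool" where
  "orientation_of D G \<longleftrightarrow>
     pverts D = pverts G \<and> parcs D \<subseteq> parcs G \<and>
     (\<forall>u v. (u, v) \<in> parcs G \<longrightarrow> ((u, v) \<in> parcs D) \<noteq> ((v, u) \<in> parcs D))"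

end

theory Submission
  imports Defs "HOL-Library.FuncSet"
begin

text \<open>
  The argument is a weighted version of the combinatorial Nullstellensatz. Giving the variable
  \<open>x\<^sub>v\<close> the weight \<open>1 / degree (f v)\<close>, the difference belonging to an edge has
  weighted degree one, and by bipartiteness its top part carries one sign on the variables of one
  class and the opposite sign on those of the other. Hence in the product over all edges every way
  of producing the monomial in which \<open>x\<^sub>v\<close> has exponent \<open>degree (f v) * outdegree v\<close>
  contributes with the same sign, and the orientation is one such way. So this coefficient does not
  vanish, and the product is nonzero at some point of every grid with more than
  \<open>degree (f v) * outdegree v\<close> labels at \<open>v\<close>.
\<close>

text \<open>The sum is the divided difference of \<open>p\<close> on \<open>S\<close>, and
  \<open>w\<close> are the Lagrange weights, built point by point by passing from \<open>p\<close>
  to its quotient by \<open>x - a\<close>. When \<open>degree p < card S - 1\<close> the value is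
  zero, which later kills the unwanted terms.\<close>

lemma coeff_as_weighted_sum:
  fixes S :: "'a::field set"
  assumes "finite S" "S \<noteq> {}"
  shows "\<exists>w. \<forall>p. degree p < card S \<longrightarrow> (\<Sum>x\<in>S. w x * poly p x) = coeff p (card S - 1)"
  using assms
proof (induction S rule: finite_ne_induct)
  case (singleton a)
  have "poly p a = coeff p 0" if "degree p = 0" for p
    using that by (elim degree_eq_zeroE) simp
  then show ?case by (intro exI[of _ "\<lambda>_. 1"]) simp
next
  case (insert a S)
  obtain w where w: "(\<Sum>x\<in>S. w x * poly q x) = coeff q (card S - 1)"
    if "degree q < card S" for q
    using insert.IH by blast
  \<comment> \<open>As \<open>poly p x - poly p a\<close> is \<open>x - a\<close> times the quotient
    at \<open>x\<close>, dividing the old weights by \<open>x - a\<close> reduces \<open>p\<close>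
    to the quotient; the weight at \<open>a\<close> supplies the subtracted
    \<open>poly p a\<close>.\<close>
  define w' where
    "w' x = (if x = a then - (\<Sum>y\<in>S. w y / (y - a)) else w x / (x - a))" for x
  have "(\<Sum>x\<in>insert a S. w' x * poly p x) = coeff p (card S)" if deg: "degree p \<le> card S" for p
  proof -
    define q where "q = synthetic_div p a"
    have p: "p = [:- a, 1:] * q + [:poly p a:]"
      using synthetic_div_correct'[of a p] by (simp add: q_def)
    have pS: "0 < card S" using insert.hyps by (simp add: card_gt_0_iff)
    have dq: "degree q < card S" using deg pS by (simp add: q_def degree_synthetic_div)
    have eval: "poly p x = (x - a) * poly q x + poly p a" for x
      using arg_cong[OF p, of "\<lambda>q. poly q x"] by (simp add: algebra_simps)
    have "coeff p (card S) = coeff ([:- a, 1:] * q + [:poly p a:]) (card S)"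
      by (rule arg_cong[OF p])
    also have "\<dots> = coeff q (card S - 1) - a * coeff q (card S)"
      using pS by (simp add: coeff_pCons split: nat.split)
    finally have co: "coeff p (card S) = coeff q (card S - 1)"
      using dq by (simp add: coeff_eq_0)
    have "(\<Sum>x\<in>insert a S. w' x * poly p x)
        = (\<Sum>x\<in>S. w x / (x - a) * poly p x) - (\<Sum>x\<in>S. w x / (x - a)) * poly p a"
    proof -
      have "(\<Sum>x\<in>S. w' x * poly p x) = (\<Sum>x\<in>S. w x / (x - a) * poly p x)"
        using insert.hyps by (intro sum.cong) (auto simp: w'_def)
      then show ?thesis using insert.hyps by (simp add: w'_def)
    qed
    also have "\<dots> = (\<Sum>x\<in>S. w x / (x - a) * (poly p x - poly p a))"
      by (simp add: sum_distrib_right sum_subtractf right_diff_distrib)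
    also have "\<dots> = (\<Sum>x\<in>S. w x * poly q x)"
    proof (intro sum.cong refl)
      fix x assume "x \<in> S"
      then have "x - a \<noteq> 0" using insert.hyps by auto
      moreover have "poly p x - poly p a = (x - a) * poly q x"
        unfolding eval[of x] by (rule add_diff_cancel_right')
      ultimately show "w x / (x - a) * (poly p x - poly p a) = w x * poly q x"
        by (metis mult.assoc nonzero_eq_divide_eq)
    qed
    finally show ?thesis using w[OF dq] co by simp
  qed
  then show ?case
    using insert.hyps by (intro exI[of _ w']) simp
qed

lemma degree_prod_le:
  fixes h :: "'e \<Rightarrow> 'a::comm_semiring_1 poly"
  assumes "finite F" "\<And>e. e \<in> F \<Longrightarrow> degree (h e) \<le> d"
  shows "degree (\<Prod>e\<in>F. h e) \<le> d * card F"
proof -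
  have "degree (\<Prod>e\<in>F. h e) \<le> (\<Sum>e\<in>F. degree (h e))"
    using degree_prod_sum_le[OF assms(1), of h] by (simp add: o_def)
  also have "\<dots> \<le> (\<Sum>e\<in>F. d)" by (intro sum_mono assms)
  finally show ?thesis by (simp add: mult.commute)
qed

text \<open>Here \<open>d\<close> is only a bound on the degrees: if some factor stays below it,
  both sides are zero.\<close>

lemma coeff_prod_top:
  fixes h :: "'e \<Rightarrow> 'a::comm_semiring_1 poly"
  assumes "finite F" "\<And>e. e \<in> F \<Longrightarrow> degree (h e) \<le> d"
  shows "coeff (\<Prod>e\<in>F. h e) (d * card F) = (\<Prod>e\<in>F. coeff (h e) d)"
  using assms
proof (induction F rule: finite_induct)
  case (insert e F)
  have *: "degree (\<Prod>e\<in>F. h e) \<le> d * card F"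
    using insert by (intro degree_prod_le) auto
  have "coeff (h e * (\<Prod>e\<in>F. h e)) (d + d * card F) = coeff (h e) d * coeff (\<Prod>e\<in>F. h e) (d * card F)"
  proof -
    \<comment> \<open>For \<open>i\<close> below \<open>d\<close> the index in the remaining product
      exceeds its degree bound, for \<open>i\<close> above \<open>d\<close> the index in
      \<open>h e\<close> does; the convolution has a single term.\<close>
    have "coeff (h e) i * coeff (\<Prod>e\<in>F. h e) (d + d * card F - i) = 0" if "i \<noteq> d" for i
    proof (cases "i < d")
      case True
      then show ?thesis using * by (simp add: coeff_eq_0)
    next
      case False
      then have "degree (h e) < i" using that insert.prems[of e] by simp
      then show ?thesis by (simp add: coeff_eq_0)
    qed
    then have "(\<Sum>i\<le>d + d * card F. coeff (h e) i * coeff (\<Prod>e\<in>F. h e) (d + d * card F - i))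
      = (\<Sum>i\<in>{d}. coeff (h e) i * coeff (\<Prod>e\<in>F. h e) (d + d * card F - i))"
      by (intro sum.mono_neutral_right) auto
    then show ?thesis by (simp add: coeff_mult)
  qed
  then show ?case using insert by simp
qed simp

text \<open>Each factor is a sum of univariate polynomials, so the product expands over choices of
  one variable per factor and multivariate polynomials are avoided. The choice \<open>\<tau>\<close>
  fixes the target monomial, and \<open>s v\<close> aligns the signs of the top coefficients at
  \<open>v\<close>.\<close>

lemma grid_nonvanishing:
  fixes h :: "'e \<Rightarrow> 'v \<Rightarrow> 'a::linordered_field poly" and d :: "'v \<Rightarrow> nat"
    and s :: "'v \<Rightarrow> 'a" and \<tau> :: "'e \<Rightarrow> 'v" and S :: "'v \<Rightarrow> 'a set"
  assumes fin: "finite V" "finite E"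
    and \<tau>: "\<tau> \<in> E \<rightarrow> V"
    and d: "\<And>v. v \<in> V \<Longrightarrow> 0 < d v"
    and deg: "\<And>e v. e \<in> E \<Longrightarrow> v \<in> V \<Longrightarrow> degree (h e v) \<le> d v"
    and nonneg: "\<And>e v. e \<in> E \<Longrightarrow> v \<in> V \<Longrightarrow> 0 \<le> s v * coeff (h e v) (d v)"
    and pos: "\<And>e. e \<in> E \<Longrightarrow> 0 < s (\<tau> e) * coeff (h e (\<tau> e)) (d (\<tau> e))"
    and S: "\<And>v. v \<in> V \<Longrightarrow> finite (S v)"
      "\<And>v. v \<in> V \<Longrightarrow> d v * card {e \<in> E. \<tau> e = v} < card (S v)"
  shows "\<exists>c. (\<forall>v\<in>V. c v \<in> S v) \<and> (\<forall>e\<in>E. (\<Sum>v\<in>V. poly (h e v) (c v)) \<noteq> 0)"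
proof -
  define m where "m \<phi> v = card {e \<in> E. \<phi> e = v}" for \<phi> :: "'e \<Rightarrow> 'v" and v
  define t where "t v = d v * m \<tau> v" for v
  \<comment> \<open>Exactly \<open>t v + 1\<close> points are kept, so that the weighted sum over
    \<open>T v\<close> reads off the coefficient at \<open>t v\<close>, the target exponent.\<close>
  have "\<exists>T\<subseteq>S v. card T = Suc (t v)" if "v \<in> V" for v
    using S(2)[OF that] obtain_subset_with_card_n[of "Suc (t v)" "S v"]
    by (auto simp: t_def m_def Suc_le_eq)
  then obtain T where T: "T v \<subseteq> S v" "card (T v) = Suc (t v)" if "v \<in> V" for v
    by metis
  have finT: "finite (T v)" if "v \<in> V" for v
    using T[OF that] S(1)[OF that] finite_subset by blast
  have "\<exists>w. \<forall>p. degree p \<le> t v \<longrightarrow> (\<Sum>x\<in>T v. w x * poly p x) = coeff p (t v)" if "v \<in> V" for v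
    using coeff_as_weighted_sum[of "T v"] finT[OF that] T(2)[OF that]
    by (cases "T v = {}") (simp_all add: less_Suc_eq_le)
  then obtain w where w: "(\<Sum>x\<in>T v. w v x * poly p x) = coeff p (t v)"
    if "v \<in> V" "degree p \<le> t v" for v p
    by metis
  define L where "L v p = (\<Sum>x\<in>T v. w v x * poly p x)" for v p
  define P where "P c = (\<Prod>e\<in>E. \<Sum>v\<in>V. poly (h e v) (c v))" for c
  \<comment> \<open>A choice \<open>\<phi>\<close> picks one summand from each factor;
    \<open>H \<phi> v\<close> collects what was picked in the variable \<open>v\<close>.\<close>
  define H where "H \<phi> v = (\<Prod>e\<in>{e \<in> E. \<phi> e = v}. h e v)" for \<phi> :: "'e \<Rightarrow> 'v" and v
  define \<Phi> where "\<Phi> = (\<Pi>\<^sub>E e\<in>E. V)"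
  have fin\<Phi>: "finite \<Phi>" unfolding \<Phi>_def by (intro finite_PiE fin)
  have P: "P c = (\<Sum>\<phi>\<in>\<Phi>. \<Prod>v\<in>V. poly (H \<phi> v) (c v))" for c
  proof -
    have "P c = (\<Sum>\<phi>\<in>\<Phi>. \<Prod>e\<in>E. poly (h e (\<phi> e)) (c (\<phi> e)))"
      unfolding P_def \<Phi>_def using fin by (intro prod_sum_PiE) auto
    also have "\<dots> = (\<Sum>\<phi>\<in>\<Phi>. \<Prod>v\<in>V. poly (H \<phi> v) (c v))"
    proof (intro sum.cong refl)
      fix \<phi> assume "\<phi> \<in> \<Phi>"
      then have "\<phi> ` E \<subseteq> V" by (auto simp: \<Phi>_def)
      then have "(\<Prod>e\<in>E. poly (h e (\<phi> e)) (c (\<phi> e)))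
          = (\<Prod>v\<in>V. \<Prod>e\<in>{e \<in> E. \<phi> e = v}. poly (h e (\<phi> e)) (c (\<phi> e)))"
        using fin by (intro prod.group[symmetric]) auto
      then show "(\<Prod>e\<in>E. poly (h e (\<phi> e)) (c (\<phi> e))) = (\<Prod>v\<in>V. poly (H \<phi> v) (c v))"
        by (simp add: H_def poly_prod)
    qed
    finally show ?thesis .
  qed
  \<comment> \<open>Each expanded term separates the variables, so its sum over the grid with
    product weights splits into one functional \<open>L v\<close> per variable.\<close>
  have "(\<Sum>c\<in>Pi\<^sub>E V T. (\<Prod>v\<in>V. w v (c v)) * P c)
      = (\<Sum>\<phi>\<in>\<Phi>. \<Sum>c\<in>Pi\<^sub>E V T. \<Prod>v\<in>V. w v (c v) * poly (H \<phi> v) (c v))"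
    by (subst sum.swap) (simp add: P sum_distrib_left prod.distrib)
  also have "\<dots> = (\<Sum>\<phi>\<in>\<Phi>. \<Prod>v\<in>V. L v (H \<phi> v))"
    unfolding L_def using fin finT by (intro sum.cong refl prod_sum_PiE[symmetric]) auto
  finally have sumP: "(\<Sum>c\<in>Pi\<^sub>E V T. (\<Prod>v\<in>V. w v (c v)) * P c) = (\<Sum>\<phi>\<in>\<Phi>. \<Prod>v\<in>V. L v (H \<phi> v))" .

  \<comment> \<open>A choice that picks every \<open>v\<close> exactly \<open>m \<tau> v\<close>
    times needs \<open>s v\<close> just as often, so a single \<open>\<sigma>\<close> corrects the
    signs of all such terms.\<close>
  define \<sigma> where "\<sigma> = (\<Prod>v\<in>V. s v ^ m \<tau> v)"
  have degH: "degree (H \<phi> v) \<le> d v * m \<phi> v" if "v \<in> V" for \<phi> v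
    unfolding H_def m_def using fin deg that by (intro degree_prod_le) auto
  have balanced: "\<sigma> * (\<Prod>v\<in>V. L v (H \<phi> v))
      = (\<Prod>v\<in>V. \<Prod>e\<in>{e \<in> E. \<phi> e = v}. s v * coeff (h e v) (d v))"
    if "\<forall>v\<in>V. m \<phi> v = m \<tau> v" for \<phi>
    unfolding \<sigma>_def prod.distrib[symmetric]
  proof (intro prod.cong refl)
    fix v assume v: "v \<in> V"
    then have m: "m \<tau> v = m \<phi> v" using that by simp
    have "L v (H \<phi> v) = coeff (H \<phi> v) (t v)"
      unfolding L_def using degH[OF v, of \<phi>] m by (intro w v) (simp add: t_def)
    also have "\<dots> = (\<Prod>e\<in>{e \<in> E. \<phi> e = v}. coeff (h e v) (d v))"
      unfolding t_def m unfolding H_def m_def using fin deg v by (intro coeff_prod_top) auto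
    finally show "s v ^ m \<tau> v * L v (H \<phi> v)
        = (\<Prod>e\<in>{e \<in> E. \<phi> e = v}. s v * coeff (h e v) (d v))"
      unfolding m by (simp add: prod.distrib m_def)
  qed
  have card_E: "(\<Sum>v\<in>V. m \<phi> v) = card E" if "\<phi> \<in> E \<rightarrow> V" for \<phi>
  proof -
    have "(\<Sum>v\<in>V. \<Sum>e\<in>{e \<in> E. \<phi> e = v}. 1) = (\<Sum>e\<in>E. (1::nat))"
      using that fin by (intro sum.group) auto
    then show ?thesis by (simp add: m_def)
  qed
  \<comment> \<open>Every choice makes \<open>card E\<close> picks in total, so if the counts
    differ, some \<open>v\<close> is picked less often than by \<open>\<tau>\<close>; there the
    degree drops below \<open>t v\<close> and \<open>L v\<close> gives zero.\<close>
  have unbalanced: "(\<Prod>v\<in>V. L v (H \<phi> v)) = 0"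
    if \<phi>: "\<phi> \<in> \<Phi>" and ne: "\<not> (\<forall>v\<in>V. m \<phi> v = m \<tau> v)" for \<phi>
  proof -
    have "\<exists>v\<in>V. m \<phi> v < m \<tau> v"
    proof (rule ccontr)
      assume "\<not> ?thesis"
      then have "\<forall>v\<in>V. m \<tau> v \<le> m \<phi> v" by (simp add: not_less)
      moreover have "\<exists>v\<in>V. m \<tau> v < m \<phi> v" using ne calculation by (force simp: le_less)
      ultimately have "(\<Sum>v\<in>V. m \<tau> v) < (\<Sum>v\<in>V. m \<phi> v)"
        using fin by (intro sum_strict_mono_ex1) auto
      moreover have "\<phi> \<in> E \<rightarrow> V" using \<phi> by (auto simp: \<Phi>_def)
      ultimately show False using card_E \<tau> by simp
    qed
    then obtain v where v: "v \<in> V" "m \<phi> v < m \<tau> v" by blast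
    then have "degree (H \<phi> v) < t v"
      using degH[OF v(1), of \<phi>] d[OF v(1)] by (simp add: t_def le_less_trans)
    then have "L v (H \<phi> v) = 0" using w[OF v(1), of "H \<phi> v"] by (simp add: L_def coeff_eq_0)
    then show ?thesis using v fin by (simp add: prod_zero_iff) blast
  qed
  \<comment> \<open>Members of \<open>\<Phi>\<close> are extensional, so \<open>\<tau>\<close> is
    cut off outside \<open>E\<close>.\<close>
  define \<rho> where "\<rho> = restrict \<tau> E"
  have \<rho>: "\<rho> \<in> \<Phi>" using \<tau> by (auto simp: \<rho>_def \<Phi>_def)
  have "0 < (\<Sum>\<phi>\<in>\<Phi>. \<sigma> * (\<Prod>v\<in>V. L v (H \<phi> v)))"
  proof (rule sum_pos2[OF fin\<Phi> \<rho>])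
    have "{e \<in> E. \<rho> e = v} = {e \<in> E. \<tau> e = v}" for v by (auto simp: \<rho>_def)
    then have "\<sigma> * (\<Prod>v\<in>V. L v (H \<rho> v))
        = (\<Prod>v\<in>V. \<Prod>e\<in>{e \<in> E. \<tau> e = v}. s v * coeff (h e v) (d v))"
      by (subst balanced) (simp_all add: m_def)
    moreover have "\<dots> > 0"
      by (intro prod_pos) (use pos in auto)
    ultimately show "0 < \<sigma> * (\<Prod>v\<in>V. L v (H \<rho> v))" by simp
  next
    fix \<phi> assume \<phi>: "\<phi> \<in> \<Phi>"
    show "0 \<le> \<sigma> * (\<Prod>v\<in>V. L v (H \<phi> v))"
    proof (cases "\<forall>v\<in>V. m \<phi> v = m \<tau> v")
      case True
      show ?thesis
        unfolding balanced[OF True] using nonneg by (intro prod_nonneg) auto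
    next
      case False
      then show ?thesis using unbalanced[OF \<phi>] by simp
    qed
  qed
  then have "(\<Sum>c\<in>Pi\<^sub>E V T. (\<Prod>v\<in>V. w v (c v)) * P c) \<noteq> 0"
    unfolding sumP sum_distrib_left[symmetric] by auto
  then obtain c where c: "c \<in> Pi\<^sub>E V T" "(\<Prod>v\<in>V. w v (c v)) * P c \<noteq> 0"
    by (rule sum.not_neutral_contains_not_neutral)
  then have "\<forall>v\<in>V. c v \<in> S v" using T(1) by blast
  moreover have "\<forall>e\<in>E. (\<Sum>v\<in>V. poly (h e v) (c v)) \<noteq> 0"
    using c(2) fin by (auto simp: P_def)
  ultimately show ?thesis by blast
qed

theorem theorem5:
  fixes G :: "'a pair_pre_digraph"
    and f :: "'a \<Rightarrow> real poly"
    and k l :: nat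
  assumes "pair_graph G"
    and "bipartite G"
    and "\<exists>D. orientation_of D G \<and> (\<forall>v\<in>pverts G. out_degree (with_proj D) v \<le> k)"
    and "\<And>v. v \<in> pverts G \<Longrightarrow> degree (f v) > 0"
    and "\<And>v. v \<in> pverts G \<Longrightarrow> degree (f v) \<le> l"
    and "\<And>v. v \<in> pverts G \<Longrightarrow> lead_coeff (f v) > 0"
  shows "\<exists>c :: 'a \<Rightarrow> nat.
    (\<forall>v\<in>pverts G. c v \<in> {1..k * l + 1}) \<and>
    (\<forall>u w. (u, w) \<in> parcs G \<longrightarrow>
      real (c u) - (\<Sum>v\<in>neighbors G u. poly (f v) (real (c v)))
      \<noteq> real (c w) - (\<Sum>v\<in>neighbors G w. poly (f v) (real (c v))))"
proof -
  interpret pair_graph G by fact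
  obtain D where D: "orientation_of D G"
    and out: "\<And>v. v \<in> pverts G \<Longrightarrow> out_degree (with_proj D) v \<le> k"
    using assms(3) by blast
  have DG: "parcs D \<subseteq> parcs G" using D by (simp add: orientation_of_def)
  obtain A B where AB: "A \<union> B = pverts G" "A \<inter> B = {}" "parcs G \<subseteq> A \<times> B \<union> B \<times> A"
    using assms(2) by (auto simp: bipartite_def)
  have sym: "(v, u) \<in> parcs G" if "(u, v) \<in> parcs G" for u v
    using that sym_arcs by (auto simp: symmetric_def dest: symD)
  have nb: "neighbors G u \<subseteq> pverts G" for u
    using AB by (auto simp: neighbors_def)
  \<comment> \<open>Bipartiteness enters through \<open>s\<close>, which changes sign along every
    edge.\<close>
  define s :: "'a \<Rightarrow> real" where "s v = (if v \<in> A then 1 else - 1)" for v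
  have s_adj: "s w = - s u" if "(u, w) \<in> parcs G" for u w
    using that AB by (auto simp: s_def)
  have s_sq: "s v * s v = 1" for v by (simp add: s_def)
  have s_cases: "s v = s u \<or> s v = - s u" for u v by (simp add: s_def)
  have s_ne: "s v \<noteq> - s v" for v by (simp add: s_def)
  define X :: "real poly" where "X = [:0, 1:]"
  \<comment> \<open>The part in the variable \<open>v\<close> of the quantity to be distinguished at
    \<open>u\<close>; \<open>X\<close> stands for the label of \<open>u\<close> itself.\<close>
  define g :: "'a \<Rightarrow> 'a \<Rightarrow> real poly" where
    "g u v = (if v = u then X else 0) - (if v \<in> neighbors G u then f v else 0)" for u v
  \<comment> \<open>The factor \<open>s u\<close> makes the result the same for both arcs of an
    edge.\<close>
  define h :: "'a \<times> 'a \<Rightarrow> 'a \<Rightarrow> real poly" where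
    "h = (\<lambda>(u, w) v. smult (s u) (g u v - g w v))"
  have eval: "(\<Sum>v\<in>pverts G. poly (g u v) (c v)) = c u - (\<Sum>v\<in>neighbors G u. poly (f v) (c v))"
    if "u \<in> pverts G" for u c
  proof -
    have "(\<Sum>v\<in>pverts G. poly (g u v) (c v))
      = (\<Sum>v\<in>pverts G. if v = u then c v else 0)
        - (\<Sum>v\<in>pverts G. if v \<in> neighbors G u then poly (f v) (c v) else 0)"
      unfolding sum_subtractf[symmetric] by (intro sum.cong) (auto simp: g_def X_def)
    also have "(\<Sum>v\<in>pverts G. if v \<in> neighbors G u then poly (f v) (c v) else 0)
      = (\<Sum>v\<in>neighbors G u. poly (f v) (c v))"
      using nb by (simp add: sum.If_cases Int_absorb1)
    finally show ?thesis using that by simp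
  qed
  \<comment> \<open>Non-constancy keeps the label term, of degree one, within the degree bound at
    \<open>v\<close>; it reaches the top only if \<open>f v\<close> is linear.\<close>
  have degX: "degree X \<le> degree (f v)" if "v \<in> pverts G" for v
    using assms(4)[OF that] by (simp add: X_def)
  have Xpos: "0 \<le> coeff X n" for n
    by (simp add: X_def coeff_pCons split: nat.split)
  have fpos: "0 < coeff (f v) (degree (f v))" if "v \<in> pverts G" for v
    using assms(6)[OF that] .
  \<comment> \<open>On the side of \<open>u\<close> only the label of \<open>u\<close> and the
    neighbors of \<open>w\<close> contribute, on the other side only the label of \<open>w\<close>
    and the neighbors of \<open>u\<close>. Within a side the signs agree, so nothing
    cancels.\<close>
  have sign: "s v * coeff (h (u, w) v) (degree (f v)) =
      (if v = u \<or> v = w then coeff X (degree (f v)) else 0)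
      + (if v \<in> neighbors G u \<union> neighbors G w then coeff (f v) (degree (f v)) else 0)"
    if uw: "(u, w) \<in> parcs G" for u w v
    using s_cases[of v u]
  proof
    assume vu: "s v = s u"
    have "v \<noteq> w" "v \<notin> neighbors G u"
      using vu s_adj[OF uw] s_adj[of u v] s_ne[of u] by (auto simp: neighbors_def)
    then show ?thesis
      by (simp add: h_def g_def vu mult.assoc[symmetric] s_sq)
  next
    assume vu: "s v = - s u"
    have "v \<noteq> u" "v \<notin> neighbors G w"
      using vu s_adj[OF uw] s_adj[of w v] s_ne[of u] by (auto simp: neighbors_def)
    then show ?thesis
      by (simp add: h_def g_def vu mult.assoc[symmetric] s_sq)
  qed
  have "\<exists>c. (\<forall>v\<in>pverts G. c v \<in> real ` {1..k * l + 1})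
      \<and> (\<forall>e\<in>parcs D. (\<Sum>v\<in>pverts G. poly (h e v) (c v)) \<noteq> 0)"
  \<comment> \<open>Each arc of \<open>D\<close> is charged to its tail, so a vertex is charged its
    out-degree, at most \<open>k\<close>. The exponent at \<open>v\<close> is then at most
    \<open>l * k\<close>, one less than the number of labels.\<close>
  proof (rule grid_nonvanishing[where \<tau> = fst and d = "\<lambda>v. degree (f v)" and s = s])
    show "finite (pverts G)" by simp
    show "finite (parcs D)" using DG by (rule finite_subset) simp
    show "fst \<in> parcs D \<rightarrow> pverts G" using DG AB by fastforce
    show "0 < degree (f v)" if "v \<in> pverts G" for v using that by fact
    show "degree (h e v) \<le> degree (f v)" if "v \<in> pverts G" for e v
    proof -
      have "degree (g u v) \<le> degree (f v)" for u
        unfolding g_def using degX[OF that] by (intro degree_diff_le) auto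
      then show ?thesis
        by (cases e) (auto simp: h_def intro!: degree_smult_le[THEN order_trans] degree_diff_le)
    qed
    show "0 \<le> s v * coeff (h e v) (degree (f v))" if "e \<in> parcs D" "v \<in> pverts G" for e v
    proof (cases e)
      case (Pair u w)
      then show ?thesis
        using that DG Xpos[of "degree (f v)"] fpos[of v] by (simp add: sign subset_iff)
    qed
    show "0 < s (fst e) * coeff (h e (fst e)) (degree (f (fst e)))" if "e \<in> parcs D" for e
    proof (cases e)
      case (Pair u w)
      then have uw: "(u, w) \<in> parcs G" using that DG by blast
      \<comment> \<open>The tail \<open>u\<close> is a neighbor of the head \<open>w\<close>, so the
        positive leading coefficient of \<open>f u\<close> occurs and makes the inequality
        strict.\<close>
      then have "u \<in> neighbors G w" "u \<in> pverts G"
        using sym AB by (auto simp: neighbors_def)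
      then show ?thesis
        using Pair Xpos[of "degree (f u)"] fpos[of u] by (simp add: sign[OF uw] add_nonneg_pos)
    qed
    show "degree (f v) * card {e \<in> parcs D. fst e = v} < card (real ` {1..k * l + 1})"
      if "v \<in> pverts G" for v
    proof -
      have "card {e \<in> parcs D. fst e = v} \<le> k"
        using out[OF that] by (simp add: out_degree_def out_arcs_def with_proj_def)
      then have "degree (f v) * card {e \<in> parcs D. fst e = v} \<le> l * k"
        using assms(5)[OF that] by (intro mult_mono) auto
      then show ?thesis by (simp add: card_image mult.commute)
    qed
  qed simp
  then obtain c where c: "\<And>v. v \<in> pverts G \<Longrightarrow> c v \<in> real ` {1..k * l + 1}"
    and nz: "\<And>e. e \<in> parcs D \<Longrightarrow> (\<Sum>v\<in>pverts G. poly (h e v) (c v)) \<noteq> 0"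
    by blast
  from c have "\<exists>n. c v = real n \<and> n \<in> {1..k * l + 1}" if "v \<in> pverts G" for v
    using that by blast
  then obtain b where b: "c v = real (b v)" "b v \<in> {1..k * l + 1}" if "v \<in> pverts G" for v
    by metis
  define F where "F u = real (b u) - (\<Sum>v\<in>neighbors G u. poly (f v) (real (b v)))" for u
  have D_ne: "F u \<noteq> F w" if uw: "(u, w) \<in> parcs D" for u w
  proof -
    have V: "u \<in> pverts G" "w \<in> pverts G" using uw DG AB by auto
    have "(\<Sum>v\<in>pverts G. poly (h (u, w) v) (c v))
        = s u * ((\<Sum>v\<in>pverts G. poly (g u v) (real (b v)))
                 - (\<Sum>v\<in>pverts G. poly (g w v) (real (b v))))"
      unfolding sum_subtractf[symmetric] sum_distrib_left
      by (intro sum.cong) (auto simp: h_def b(1))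
    also have "\<dots> = s u * (F u - F w)"
      using eval[OF V(1), of "\<lambda>v. real (b v)"] eval[OF V(2), of "\<lambda>v. real (b v)"]
      by (simp add: F_def)
    finally show ?thesis using nz[OF uw] by auto
  qed
  have "F u \<noteq> F w" if "(u, w) \<in> parcs G" for u w
  proof (cases "(u, w) \<in> parcs D")
    case False
    then have "(w, u) \<in> parcs D" using that D by (auto simp: orientation_of_def)
    then show ?thesis using D_ne by metis
  qed (rule D_ne)
  then show ?thesis
    using b(2) by (intro exI[of _ b]) (simp add: F_def)
qed

end
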